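(* Let $\{X_t\}_{t\in\mathbb{Z}}$ be a stationary FIEGARCH$(p,d,q)$ process and $\mathcal{F}_t:=\sigma(\{Z_s\}_{s\le t})$. Then, for any fixed $n\in\mathbb{Z}$, the $h$-step ahead forecast of $X_{n+h}$ for every integer $h>0$, and the $1$-step ahead forecast of $X_{n+1}^2$, given $\mathcal{F}_n$, are respectively $$\hat X_{n+h}:=\mathbb{E}(X_{n+h}\mid\mathcal{F}_n)=0\quad\text{and}\quad \hat X_{n+1}^2:=\mathbb{E}(X_{n+1}^2\mid\mathcal{F}_n)=\sigma_{n+1}^2\qquad\text{almost surely}.$$
   Context: FIEGARCH$(p,d,q)$: let $\{Z_t\}_{t\in\mathbb{Z}}$ be i.i.d. real random variables with mean $0$ and variance $1$; let $d,\omega,\theta,\gamma\in\mathbb{R}$; let $\alpha(z)=1-\sum_{i=1}^p\alpha_iz^i$, $\beta(z)=1-\sum_{j=1}^q\beta_jz^j$ be real polynomials with no common roots and $\beta(z)\neq0$ for $|z|\le1$. Let $\lambda_{d,k}$ be defined by $\frac{\alpha(z)}{\beta(z)}(1-z)^{-d}=\sum_{k=0}^\infty\lambda_{d,k}z^k$ for $|z|<1$, and put $g(Z_t)=\theta Z_t+\gamma\,[\,|Z_t|-\mathbb{E}(|Z_t|)\,]$. Then $X_t=\sigma_tZ_t$ with $\sigma_t>0$ given by $$\ln(\sigma_t^2)=\omega+\sum_{k=0}^\infty\lambda_{d,k}\,g(Z_{t-1-k}),\qquad t\in\mathbb{Z},$$ where the process is assumed well defined, i.e. the series converges almost surely to a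 finite limit. Stationary means weakly and strictly stationary; in particular $\mathbb{E}(X_t^2)<\infty$. The $h$-step ahead forecast of a random variable $Y_{n+h}$ given $\mathcal{F}_n$ is the conditional expectation $\mathbb{E}(Y_{n+h}\mid\mathcal{F}_n)$. $\sigma$-fields are completed by null sets. *)

theory Defs
  imports "HOL-Probability.Probability"
begin

definition lag_poly :: "nat \<Rightarrow> (nat \<Rightarrow> real) \<Rightarrow> real poly" where
  "lag_poly r c = 1 - (\<Sum>i=1..r. monom (c i) i)"

text \<open>
  Real polynomials are evaluated at complex arguments, since conditions on roots and the
  power series identity on the unit disc refer to complex \<open>z\<close>.
\<close>

abbreviation cpoly :: "real poly \<Rightarrow> complex \<Rightarrow> complex" where
  "cpoly P z \<equiv> poly (map_poly complex_of_real P) z"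

text \<open>
  For \<open>norm z < 1\<close> the number \<open>1 - z\<close> lies in the right half-plane, so the principal branch
  used by \<open>powr\<close> is the holomorphic one with value 1 at \<open>z = 0\<close>. The sequence
  \<open>lam\<close> is thereby uniquely determined.
\<close>

definition fiegarch_coeffs ::
  "nat \<Rightarrow> nat \<Rightarrow> (nat \<Rightarrow> real) \<Rightarrow> (nat \<Rightarrow> real) \<Rightarrow> real \<Rightarrow> (nat \<Rightarrow> real) \<Rightarrow> bool" where
  "fiegarch_coeffs p q \<alpha> \<beta> d lam \<longleftrightarrow>
     (\<forall>z::complex. norm z < 1 \<longrightarrow>
        (\<lambda>k. complex_of_real (lam k) * z ^ k) sums
          (cpoly (lag_poly p \<alpha>) z / cpoly (lag_poly q \<beta>) z * (1 - z) powr (- complex_of_real d)))"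

text \<open>
  The identities defining the process hold almost surely, so \<open>\<sigma>\<close> and \<open>X\<close> are only
  determined up to modification. The constant \<open>\<omega>\<close> is a model parameter; points of the sample
  space are called \<open>x\<close>.
\<close>

locale fiegarch = prob_space M for M :: "'a measure" +
  fixes p q :: nat and \<alpha> \<beta> :: "nat \<Rightarrow> real" and d \<omega> \<theta> \<gamma> :: real
    and lam :: "nat \<Rightarrow> real" and Z \<sigma> X :: "int \<Rightarrow> 'a \<Rightarrow> real"
  assumes indep: "indep_vars (\<lambda>_. borel) Z UNIV"
    and ident: "\<And>s t. distr M borel (Z s) = distr M borel (Z t)"
    and integrable_Z: "\<And>t. integrable M (Z t)"
    and integrable_Z_sq: "\<And>t. integrable M (\<lambda>x. (Z t x)\<^sup>2)"
    and mean_Z: "\<And>t. expectation (Z t) = 0"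
    and variance_Z: "\<And>t. variance (Z t) = 1"
    and no_common_roots:
      "\<And>z. \<not> (cpoly (lag_poly p \<alpha>) z = 0 \<and> cpoly (lag_poly q \<beta>) z = 0)"
    and beta_nonzero: "\<And>z. norm z \<le> 1 \<Longrightarrow> cpoly (lag_poly q \<beta>) z \<noteq> 0"
    and coeffs: "fiegarch_coeffs p q \<alpha> \<beta> d lam"
    and random_variable_\<sigma>: "\<And>t. random_variable borel (\<sigma> t)"
    and random_variable_X: "\<And>t. random_variable borel (X t)"
    and \<sigma>_pos: "\<And>t. AE x in M. \<sigma> t x > 0"
    and X_eq: "\<And>t. AE x in M. X t x = \<sigma> t x * Z t x"
    and log_volatility: "\<And>t. AE x in M.
      (let g = (\<lambda>s. \<theta> * Z s x + \<gamma> * (\<bar>Z s x\<bar> - expectation (\<lambda>y. \<bar>Z s y\<bar>)))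
       in summable (\<lambda>k. lam k * g (t - 1 - int k)) \<and>
          ln ((\<sigma> t x)\<^sup>2) = \<omega> + (\<Sum>k. lam k * g (t - 1 - int k)))"

context prob_space
begin

definition weakly_stationary :: "(int \<Rightarrow> 'a \<Rightarrow> real) \<Rightarrow> bool" where
  "weakly_stationary X \<longleftrightarrow>
     (\<forall>t. random_variable borel (X t) \<and> integrable M (\<lambda>x. (X t x)\<^sup>2)) \<and>
     (\<forall>s t. expectation (X s) = expectation (X t)) \<and>
     (\<forall>s t k.
        expectation (\<lambda>x. (X (s + k) x - expectation (X (s + k))) *
                         (X (t + k) x - expectation (X (t + k)))) =
        expectation (\<lambda>x. (X s x - expectation (X s)) * (X t x - expectation (X t))))"

definition strictly_stationary :: "(int \<Rightarrow> 'a \<Rightarrow> real) \<Rightarrow> bool" where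
  "strictly_stationary X \<longleftrightarrow>
     (\<forall>t. random_variable borel (X t)) \<and>
     (\<forall>J k. finite J \<longrightarrow>
        distr M (Pi\<^sub>M J (\<lambda>_. borel)) (\<lambda>x. \<lambda>t\<in>J. X (t + k) x) =
        distr M (Pi\<^sub>M J (\<lambda>_. borel)) (\<lambda>x. \<lambda>t\<in>J. X t x))"

text \<open>
  The \<open>\<sigma>\<close>-field generated by \<open>Z s\<close> for \<open>s \<le> t\<close>, completed by the null sets of \<open>M\<close>.
  If \<open>M\<close> is complete, \<open>null_sets M\<close> contains all subsets of null sets; completeness of \<open>M\<close>
  is not required, and in general only measurable null sets are added, which keeps the result
  a sub-\<open>\<sigma>\<close>-field of \<open>M\<close> as conditional expectations demand.
\<close>

definition past :: "(int \<Rightarrow> 'a \<Rightarrow> real) \<Rightarrow> int \<Rightarrow> 'a measure" where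
  "past Z t = sigma (space M)
     ((\<Union>s\<in>{..t}. {Z s -` A \<inter> space M | A. A \<in> sets borel}) \<union> null_sets M)"

lemma subalgebra_past:
  assumes "\<And>t. random_variable borel (Z t)"
  shows "subalgebra M (past Z t)"
proof -
  let ?G = "(\<Union>s\<in>{..t}. {Z s -` A \<inter> space M | A. A \<in> sets borel}) \<union> null_sets M"
  have G: "?G \<subseteq> sets M"
    using measurable_sets[OF assms] by auto
  then have P: "?G \<subseteq> Pow (space M)"
    using sets.space_closed by blast
  show ?thesis
    unfolding subalgebra_def past_def
    using sets.sigma_sets_subset[OF G] by (simp add: space_measure_of[OF P] sets_measure_of[OF P])
qed

end

end

theory Submission
  imports Defs
begin

text \<open>
  Up to a null set, \<open>\<sigma> t\<close> is the exponential of a series in the \<open>Z s\<close> with \<open>s < t\<close>, so it can be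
  pulled out of the conditional expectation of \<open>X t = \<sigma> t * Z t\<close> or its square given the past
  up to \<open>t - 1\<close>. As \<open>Z t\<close> is independent of that past, what remains is \<open>E (Z t) = 0\<close> or
  \<open>E ((Z t)\<^sup>2) = 1\<close>. The tower property gives horizons \<open>h > 1\<close>.
\<close>

context prob_space
begin

lemma sigma_finite_subalgebraI:
  assumes "subalgebra M F"
  shows "sigma_finite_subalgebra M F"
  by (intro finite_measure_subalgebra_is_sigma_finite)
    (simp add: finite_measure_subalgebra_def finite_measure_subalgebra_axioms_def assms)

lemma indep_set_mono:
  assumes "indep_set A B" and "A' \<subseteq> A" and "B' \<subseteq> B"
  shows "indep_set A' B'"
  using assms(1) unfolding indep_set_def
  by (rule indep_sets_mono_sets) (use assms in \<open>simp split: bool.split\<close>)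

text \<open>The indicator of any \<open>A\<close> in \<open>F\<close> is independent of
  \<open>Y\<close>, so the integral of \<open>Y\<close> over \<open>A\<close> factors into
  \<open>prob A * expectation Y\<close>. This is the integral of the constant
  \<open>expectation Y\<close> over \<open>A\<close>, and such integrals characterise the
  conditional expectation.\<close>

lemma real_cond_exp_indep:
  fixes Y :: "'a \<Rightarrow> real"
  assumes F: "subalgebra M F" and Y: "integrable M Y"
    and ind: "indep_set (sets F) (sigma_sets (space M) {Y -` A \<inter> space M | A. A \<in> sets borel})"
  shows "AE x in M. real_cond_exp M F Y x = expectation Y"
proof -
  interpret sigma_finite_subalgebra M F by (rule sigma_finite_subalgebraI[OF F])
  have [measurable]: "random_variable borel Y" using Y by simp
  show ?thesis
  proof (rule real_cond_exp_charact)
    fix A assume A: "A \<in> sets F"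
    then have A' [measurable]: "A \<in> events" using F by (auto simp: subalgebra_def)
    have ind_meas: "indicator A \<in> borel_measurable F" using A by simp
    \<comment> \<open>Every event described by the indicator already lies in \<open>F\<close>, so
      independence of \<open>F\<close> and \<open>Y\<close> restricts to independence of two random
      variables, for which the product formula for expectations is available.\<close>
    have "{indicator A -` B \<inter> space M | B. B \<in> sets (borel :: real measure)} \<subseteq> sets F"
      using measurable_sets[OF ind_meas] F by (auto simp: subalgebra_def)
    then have "sigma_sets (space M) {indicator A -` B \<inter> space M | B. B \<in> sets (borel :: real measure)}
        \<subseteq> sets F"
      using sets.sigma_sets_subset[of _ F] F by (simp add: subalgebra_def)
    then have "indep_var borel (indicator A :: 'a \<Rightarrow> real) borel Y"
      unfolding indep_var_eq by (intro conjI indep_set_mono[OF ind]) auto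
    moreover have "integrable M (indicator A :: 'a \<Rightarrow> real)"
      using A' by (simp add: emeasure_eq_measure)
    ultimately have "(\<integral>x. indicator A x * Y x \<partial>M) = (\<integral>x. indicator A x \<partial>M) * expectation Y"
      by (intro indep_var_lebesgue_integral Y) auto
    then show "(\<integral>x\<in>A. Y x \<partial>M) = (\<integral>x\<in>A. expectation Y \<partial>M)"
      by (simp add: set_lebesgue_integral_def)
  qed (use Y in auto)
qed

lemma sets_past:
  assumes "\<And>t. random_variable borel (Z t)"
  shows "sets (past Z t) = sigma_sets (space M)
    ((\<Union>s\<in>{..t}. {Z s -` A \<inter> space M | A. A \<in> sets borel}) \<union> null_sets M)"
  unfolding past_def
  using sets.space_closed by (intro sets_measure_of) (fastforce simp: null_sets_def)

text \<open>Null sets are independent of everything: an intersection with a null set has probability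
  0, and so does the matching product. They enter as one more family under the fresh index
  \<open>None\<close>, so that the completion built into \<open>past\<close> can be treated like any
  other generator.\<close>

lemma indep_sets_null_sets:
  assumes "indep_sets E I"
  shows "indep_sets (case_option (null_sets M) E) (insert None (Some ` I))"
proof (rule indep_setsI)
  have "E i \<subseteq> events" if "i \<in> I" for i
    using assms that by (simp add: indep_sets_def)
  then show ev: "case_option (null_sets M) E i \<subseteq> events" if "i \<in> insert None (Some ` I)" for i
    using that by (cases i) auto
  fix A J
  assume J: "J \<noteq> {}" "J \<subseteq> insert None (Some ` I)" "finite J"
    and A: "\<forall>j\<in>J. A j \<in> case_option (null_sets M) E j"
  show "prob (\<Inter>j\<in>J. A j) = (\<Prod>j\<in>J. prob (A j))"
  proof (cases "None \<in> J")
    case True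
    then have "A None \<in> null_sets M" using A by force
    moreover have "A j \<in> events" if "j \<in> J" for j
      using A J(2) ev that by blast
    then have "(\<Inter>j\<in>J. A j) \<in> events" using J by auto
    ultimately have "prob (\<Inter>j\<in>J. A j) = 0" "prob (A None) = 0"
      using True by (auto intro!: measure_eq_0_null_sets intro: null_sets_subset)
    then show ?thesis using True J by (auto intro!: prod_zero[symmetric])
  next
    case False
    \<comment> \<open>Without \<open>None\<close> only original families are involved, and the claim
      is the assumed independence after reindexing along \<open>Some\<close>.\<close>
    then obtain K where K: "J = Some ` K" "K \<subseteq> I"
      using J(2) by (metis subset_image_iff subset_insert)
    then have "finite K" "K \<noteq> {}" using J by (auto dest: finite_imageD)
    then show ?thesis
      using indep_setsD[OF assms K(2), of "A \<circ> Some"] A K by (simp add: prod.reindex)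
  qed
qed

text \<open>Independent families that are stable under intersection may be grouped into disjoint
  blocks, and the \<sigma>-fields generated by the blocks are again independent.\<close>

lemma indep_set_past:
  assumes Z: "indep_vars (\<lambda>_. borel) Z UNIV" and "t < s"
  shows "indep_set (sets (past Z t)) (sigma_sets (space M) {Z s -` A \<inter> space M | A. A \<in> sets borel})"
proof -
  define E where "E s = {Z s -` A \<inter> space M | A. A \<in> sets borel}" for s
  have rv: "random_variable borel (Z t)" for t
    using Z by (auto simp: indep_vars_def2)
  have E_stable: "Int_stable (E s)" for s
    unfolding Int_stable_def E_def
  proof safe
    fix A B :: "real set" assume "A \<in> sets borel" "B \<in> sets borel"
    then show "\<exists>C. Z s -` A \<inter> space M \<inter> (Z s -` B \<inter> space M) = Z s -` C \<inter> space M \<and> C \<in> sets borel"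
      by (intro exI[of _ "A \<inter> B"]) auto
  qed
  \<comment> \<open>The block \<open>True\<close> generates \<open>past Z t\<close>, null sets
    included; the block \<open>False\<close> is \<open>Z s\<close> alone. They are disjoint because
    \<open>t < s\<close>.\<close>
  define I where "I b = (if b then insert None (Some ` {..t}) else {Some s})" for b
  have "indep_sets E UNIV" using Z unfolding indep_vars_def2 E_def by simp
  from indep_sets_null_sets[OF this]
  have "indep_sets (case_option (null_sets M) E) (\<Union>b\<in>UNIV. I b)"
    by (rule indep_sets_mono_index[rotated]) (auto simp: I_def)
  then have "indep_sets (\<lambda>b. sigma_sets (space M) (\<Union>i\<in>I b. case_option (null_sets M) E i)) UNIV"
  proof (rule indep_sets_collect_sigma)
    show "Int_stable (case_option (null_sets M) E i)" for i
      using E_stable by (cases i) (auto simp: Int_stable_def)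
    show "disjoint_family_on I UNIV"
      using \<open>t < s\<close> by (auto simp: disjoint_family_on_def I_def)
  qed
  then show ?thesis
    unfolding indep_set_def
    by (rule indep_sets_mono_sets) (auto simp: I_def E_def sets_past[OF rv] Un_commute split: bool.splits)
qed

text \<open>Events described by \<open>\<phi> (Z s)\<close> are events described by
  \<open>Z s\<close>, so independence of the past carries over to functions of \<open>Z s\<close>,
  in particular to its powers.\<close>

lemma real_cond_exp_past_indep:
  fixes \<phi> :: "real \<Rightarrow> real"
  assumes Z: "indep_vars (\<lambda>_. borel) Z UNIV" and "t < s"
    and [measurable]: "\<phi> \<in> borel_measurable borel" and int: "integrable M (\<lambda>x. \<phi> (Z s x))"
  shows "AE x in M. real_cond_exp M (past Z t) (\<lambda>x. \<phi> (Z s x)) x = expectation (\<lambda>x. \<phi> (Z s x))"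
proof (rule real_cond_exp_indep[OF _ int])
  show "subalgebra M (past Z t)"
    using Z by (intro subalgebra_past) (auto simp: indep_vars_def2)
  have "{(\<lambda>x. \<phi> (Z s x)) -` A \<inter> space M | A. A \<in> sets borel}
      \<subseteq> {Z s -` A \<inter> space M | A. A \<in> sets borel}"
  proof safe
    fix A :: "real set" assume "A \<in> sets borel"
    then show "\<exists>B. (\<lambda>x. \<phi> (Z s x)) -` A \<inter> space M = Z s -` B \<inter> space M \<and> B \<in> sets borel"
      using measurable_sets[of \<phi> borel borel A] by (intro exI[of _ "\<phi> -` A"]) auto
  qed
  then have "sigma_sets (space M) {(\<lambda>x. \<phi> (Z s x)) -` A \<inter> space M | A. A \<in> sets borel}
      \<subseteq> sigma_sets (space M) {Z s -` A \<inter> space M | A. A \<in> sets borel}"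
    by (rule sigma_sets_mono')
  then show "indep_set (sets (past Z t))
      (sigma_sets (space M) {(\<lambda>x. \<phi> (Z s x)) -` A \<inter> space M | A. A \<in> sets borel})"
    by (intro indep_set_mono[OF indep_set_past[OF Z \<open>t < s\<close>]]) auto
qed

lemma measurable_past:
  assumes "\<And>t. random_variable borel (Z t)" and "s \<le> t"
  shows "Z s \<in> borel_measurable (past Z t)"
proof (rule measurableI)
  fix A :: "real set" assume "A \<in> sets borel"
  then show "Z s -` A \<inter> space (past Z t) \<in> sets (past Z t)"
    using subalgebra_past[of Z t] assms
    by (auto simp: sets_past subalgebra_def)
qed simp

lemma subalgebra_past_mono:
  assumes "\<And>t. random_variable borel (Z t)" and "s \<le> t"
  shows "subalgebra (past Z t) (past Z s)"
proof -
  have "sets (past Z s) \<subseteq> sets (past Z t)"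
    unfolding sets_past[OF assms(1)] using \<open>s \<le> t\<close> by (intro sigma_sets_mono') force
  then show ?thesis
    using subalgebra_past[of Z s] subalgebra_past[of Z t] assms(1) by (auto simp: subalgebra_def)
qed

end

context fiegarch
begin

lemma random_variable_Z: "random_variable borel (Z t)"
  using integrable_Z by (rule borel_measurable_integrable)

text \<open>The series runs over \<open>Z (t - 1 - k)\<close> with \<open>k \<ge> 0\<close>, all of
  them in the past up to \<open>t - 1\<close>. Since the model equation holds only almost surely, it
  is solved for a version \<open>S\<close> given by an explicit formula whose measurability is
  evident.\<close>

lemma volatility_past_version:
  obtains S where "S \<in> borel_measurable (past Z (t - 1))" "AE x in M. \<sigma> t x = S x"
proof
  define g where "g s x = \<theta> * Z s x + \<gamma> * (\<bar>Z s x\<bar> - expectation (\<lambda>y. \<bar>Z s y\<bar>))" for s x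
  let ?S = "\<lambda>x. exp ((\<omega> + (\<Sum>k. lam k * g (t - 1 - int k) x)) / 2)"
  have [measurable]: "g (t - 1 - int k) \<in> borel_measurable (past Z (t - 1))" for k
  proof -
    have [measurable]: "Z (t - 1 - int k) \<in> borel_measurable (past Z (t - 1))"
      by (intro measurable_past random_variable_Z) simp
    show ?thesis unfolding g_def by measurable
  qed
  show "?S \<in> borel_measurable (past Z (t - 1))" by measurable
  show "AE x in M. \<sigma> t x = ?S x"
    using \<sigma>_pos[of t] log_volatility[of t]
  proof eventually_elim
    case (elim x)
    \<comment> \<open>Positivity of the volatility turns the logarithm of its square into twice its
      logarithm, whence the division by 2 in \<open>?S\<close>.\<close>
    then have "2 * ln (\<sigma> t x) = \<omega> + (\<Sum>k. lam k * g (t - 1 - int k) x)"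
      by (simp add: g_def Let_def ln_realpow)
    then show ?case using elim(1) by (metis exp_ln nonzero_mult_div_cancel_left zero_neq_numeral)
  qed
qed

text \<open>A general exponent handles the forecasts of \<open>X\<close> and of its square together,
  as the cases \<open>m = 1\<close> and \<open>m = 2\<close>.\<close>

lemma real_cond_exp_past_power:
  assumes int_X: "integrable M (\<lambda>x. X t x ^ m)" and int_Z: "integrable M (\<lambda>x. Z t x ^ m)"
  shows "AE x in M. real_cond_exp M (past Z (t - 1)) (\<lambda>x. X t x ^ m) x
    = \<sigma> t x ^ m * expectation (\<lambda>x. Z t x ^ m)"
proof -
  note [measurable] = random_variable_Z random_variable_X
  have sub: "subalgebra M (past Z (t - 1))" by (intro subalgebra_past random_variable_Z)
  interpret sigma_finite_subalgebra M "past Z (t - 1)" by (rule sigma_finite_subalgebraI[OF sub])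
  obtain S where [measurable]: "S \<in> borel_measurable (past Z (t - 1))"
    and S: "AE x in M. \<sigma> t x = S x"
    by (rule volatility_past_version)
  have [measurable]: "random_variable borel S" using sub by (rule measurable_from_subalg) simp
  have X: "AE x in M. X t x ^ m = S x ^ m * Z t x ^ m"
    using S X_eq[of t] by eventually_elim (simp add: power_mult_distrib)
  \<comment> \<open>Pulling out a factor requires an integrable product; this is inherited from
    \<open>X t x ^ m\<close> through almost sure equality, with no moment condition on
    \<open>S\<close>.\<close>
  have "integrable M (\<lambda>x. S x ^ m * Z t x ^ m)"
    using int_X X by (subst (asm) integrable_cong_AE) auto
  then have "AE x in M. real_cond_exp M (past Z (t - 1)) (\<lambda>x. S x ^ m * Z t x ^ m) x
      = S x ^ m * real_cond_exp M (past Z (t - 1)) (\<lambda>x. Z t x ^ m) x"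
    by (intro real_cond_exp_mult) auto
  moreover have "AE x in M. real_cond_exp M (past Z (t - 1)) (\<lambda>x. X t x ^ m) x
      = real_cond_exp M (past Z (t - 1)) (\<lambda>x. S x ^ m * Z t x ^ m) x"
    using X by (intro real_cond_exp_cong) auto
  moreover have "AE x in M. real_cond_exp M (past Z (t - 1)) (\<lambda>x. Z t x ^ m) x
      = expectation (\<lambda>x. Z t x ^ m)"
    using real_cond_exp_past_indep[OF indep, of "t - 1" t "\<lambda>z. z ^ m"] int_Z by simp
  ultimately show ?thesis using S by eventually_elim simp
qed

end

theorem lemma2:
  fixes M :: "'a measure"
    and p q :: nat and \<alpha> \<beta> :: "nat \<Rightarrow> real" and d \<omega> \<theta> \<gamma> :: real
    and lam :: "nat \<Rightarrow> real" and Z \<sigma> X :: "int \<Rightarrow> 'a \<Rightarrow> real" and n :: int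
  assumes "fiegarch M p q \<alpha> \<beta> d \<omega> \<theta> \<gamma> lam Z \<sigma> X"
    and "prob_space.weakly_stationary M X"
    and "prob_space.strictly_stationary M X"
  shows "(\<forall>h::int. h > 0 \<longrightarrow>
            (AE x in M. real_cond_exp M (prob_space.past M Z n) (X (n + h)) x = 0)) \<and>
         (AE x in M.
            real_cond_exp M (prob_space.past M Z n) (\<lambda>y. (X (n + 1) y)\<^sup>2) x = (\<sigma> (n + 1) x)\<^sup>2)"
proof -
  interpret fiegarch M p q \<alpha> \<beta> d \<omega> \<theta> \<gamma> lam Z \<sigma> X by fact
  have int_X2: "integrable M (\<lambda>x. (X t x)\<^sup>2)" for t
    using assms(2) by (simp add: weakly_stationary_def)
  have int_X: "integrable M (X t)" for t
    by (rule square_integrable_imp_integrable[OF random_variable_X int_X2])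
  have sub: "subalgebra M (past Z t)" for t by (intro subalgebra_past random_variable_Z)
  interpret sigma_finite_subalgebra M "past Z n" by (rule sigma_finite_subalgebraI[OF sub])
  have "AE x in M. real_cond_exp M (past Z n) (X (n + h)) x = 0" if "h > 0" for h
  proof -
    \<comment> \<open>Conditioning first on the past just before \<open>n + h\<close> makes the
      forecast vanish; since \<open>h > 0\<close>, this past contains \<open>past Z n\<close>. For
      \<open>h = 1\<close> the two coincide, so no case distinction arises.\<close>
    let ?Y = "real_cond_exp M (past Z (n + h - 1)) (X (n + h))"
    have Y0: "AE x in M. ?Y x = 0"
      using real_cond_exp_past_power[of "n + h" 1] int_X integrable_Z mean_Z by simp
    have "AE x in M. real_cond_exp M (past Z n) ?Y x = real_cond_exp M (past Z n) (X (n + h)) x"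
      using that int_X by (intro real_cond_exp_nested_subalg sub subalgebra_past_mono random_variable_Z) auto
    moreover have "AE x in M. real_cond_exp M (past Z n) ?Y x = real_cond_exp M (past Z n) (\<lambda>_. 0) x"
      using Y0 by (intro real_cond_exp_cong) auto
    moreover have "AE x in M. real_cond_exp M (past Z n) (\<lambda>_. 0) x = 0"
      by (rule real_cond_exp_F_meas) auto
    ultimately show ?thesis by eventually_elim simp
  qed
  moreover have "expectation (\<lambda>x. (Z t x)\<^sup>2) = 1" for t
    using variance_Z[of t] by (simp add: mean_Z)
  \<comment> \<open>At horizon 1 the past just before \<open>n + 1\<close> is
    \<open>past Z n\<close> itself, so the squared volatility is already known and survives the
    conditioning.\<close>
  then have "AE x in M. real_cond_exp M (past Z n) (\<lambda>y. (X (n + 1) y)\<^sup>2) x = (\<sigma> (n + 1) x)\<^sup>2"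
    using real_cond_exp_past_power[OF int_X2 integrable_Z_sq, of "n + 1"] by simp
  ultimately show ?thesis by blast
qed

end
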